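(* For any signature $S$: (i) the labeling $\lambda$ is an EL-labeling of the poset $(T(S),\preceq)$; (ii) between any two elements $t_1\preceq t_2$ of this poset there is at most one $\lambda$-weakly decreasing saturated chain.
   Context: A signature is a set $S$ with an arity map $|\cdot|:S\to\mathbb N$. An $S$-term is either the leaf $\ell$ or $s\,t_1\cdots t_{|s|}$ with $s\in S$ and $S$-terms $t_i$; $T(S)$ is the set of $S$-terms. Preorder traversal: root, then subterms left to right recursively. Internal nodes are numbered $1,\dots,\deg t$ in preorder; $\mathrm{dc}(t)$ is the word of their decorations. Children (leaves included) are numbered from $1$ left to right. An edge of $t$ is a triple $(i_1,j,i_2)$ of internal nodes with $i_2$ the $j$-th child of $i_1$; by convention $(1,0,1)$ is also an edge when $\deg t\ge1$. Each internal node $i$ has a unique parent edge $(\mathrm{pa}(i),\mathrm{lp}(i),i)$. Connection word: $\mathrm{cnc}(t)(i)=\mathrm{pa}(i)+1-2^{\mathrm{lp}(i)-a}$, $a$ the arity of the decoration of $\mathrm{pa}(i)$. Order: $t_1\preceq t_2$ iff $\mathrm{dc}(t_1)=\mathrm{dc}(t_2)$ and $\mathrm{cnc}(t_1)\le\mathrm{cnc}(t_2)$ componentwise. For $i\ge1$, $t_1\to_i t_2$ when node $i$ of $t_1$ is visited immediately after a leaf $x$ in preorder and $t_2$ is obtained by detaching the subterm rooted at $i$ (a leaf replacing it) and grafting it in place of $x$; $\to=\bigcup_i\to_i$, which is the covering relation of $\preceq$. When $t_1\to t_2$, exactly one edge $(i_1,j_1,i)$ of $t_1$ is not an edge of $t_2$,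 and the labeling is $\lambda(t_1,t_2):=(i,i_1,-j_1)\in\mathbb Z^3$, with $\mathbb Z^3$ ordered lexicographically. For a saturated chain $c=(c_1,\dots,c_k)$, $\bar\lambda(c)$ is the word $\lambda(c_1,c_2)\cdots\lambda(c_{k-1},c_k)$. The chain is $\lambda$-increasing (resp. $\lambda$-weakly decreasing) if this word is strictly increasing (resp. weakly decreasing), and $c$ is $\lambda$-smaller than $c'$ if $\bar\lambda(c)$ is lexicographically smaller than $\bar\lambda(c')$. $\lambda$ is an EL-labeling if for all $x\preceq x'$ there is exactly one $\lambda$-increasing saturated chain from $x$ to $x'$, and it is $\lambda$-smaller than every other saturated chain from $x$ to $x'$. *)

theory Defs
  imports Complex_Main "HOL-Library.Product_Lexorder"
begin

datatype 's trm = Leaf | Node (root: 's) (children: "'s trm list")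

inductive_set terms :: "'s set \<Rightarrow> ('s \<Rightarrow> nat) \<Rightarrow> 's trm set"
  for S :: "'s set" and ar :: "'s \<Rightarrow> nat" where
  Leaf: "Leaf \<in> terms S ar"
| Node: "s \<in> S \<Longrightarrow> length ts = ar s \<Longrightarrow> (\<And>t. t \<in> set ts \<Longrightarrow> t \<in> terms S ar)
    \<Longrightarrow> Node s ts \<in> terms S ar"

text \<open>A position in a term is the list of child numbers, counted from 1, on the path from the root.\<close>

primrec preorder :: "'s trm \<Rightarrow> nat list list" where
  "preorder Leaf = [[]]"
| "preorder (Node s ts) =
     [] # concat (map (\<lambda>(j, ps). map ((#) j) ps) (enumerate 1 (map preorder ts)))"

text \<open>The next two functions are only meaningful at positions occurring in the term.\<close>

fun subterm :: "'s trm \<Rightarrow> nat list \<Rightarrow> 's trm" where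
  "subterm t [] = t"
| "subterm (Node s ts) (j # p) = subterm (ts ! (j - 1)) p"

fun replace :: "'s trm \<Rightarrow> nat list \<Rightarrow> 's trm \<Rightarrow> 's trm" where
  "replace t [] u = u"
| "replace (Node s ts) (j # p) u = Node s (ts[j - 1 := replace (ts ! (j - 1)) p u])"

definition nodes :: "'s trm \<Rightarrow> nat list list" where
  "nodes t = filter (\<lambda>p. subterm t p \<noteq> Leaf) (preorder t)"

definition deg :: "'s trm \<Rightarrow> nat" where
  "deg t = length (nodes t)"

text \<open>Internal nodes are numbered from 1, whereas list indices start at 0.\<close>

definition node :: "'s trm \<Rightarrow> nat \<Rightarrow> nat list" where
  "node t i = nodes t ! (i - 1)"

definition dc :: "'s trm \<Rightarrow> 's list" where
  "dc t = map (\<lambda>p. root (subterm t p)) (nodes t)"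

definition edges :: "'s trm \<Rightarrow> (nat \<times> nat \<times> nat) set" where
  "edges t =
     {(i1, j, i2). i1 \<in> {1..deg t} \<and> i2 \<in> {1..deg t} \<and> node t i2 = node t i1 @ [j]} \<union>
     (if deg t \<ge> 1 then {(1, 0, 1)} else {})"

definition pa :: "'s trm \<Rightarrow> nat \<Rightarrow> nat" where
  "pa t i = (THE i1. \<exists>j. (i1, j, i) \<in> edges t)"

definition lp :: "'s trm \<Rightarrow> nat \<Rightarrow> nat" where
  "lp t i = (THE j. \<exists>i1. (i1, j, i) \<in> edges t)"

definition cnc :: "('s \<Rightarrow> nat) \<Rightarrow> 's trm \<Rightarrow> nat \<Rightarrow> real" where
  "cnc ar t i = real (pa t i) + 1 - 2 powi (int (lp t i) - int (ar (dc t ! (pa t i - 1))))"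

definition term_le :: "('s \<Rightarrow> nat) \<Rightarrow> 's trm \<Rightarrow> 's trm \<Rightarrow> bool" where
  "term_le ar t1 t2 \<longleftrightarrow> dc t1 = dc t2 \<and> (\<forall>i\<in>{1..deg t1}. cnc ar t1 i \<le> cnc ar t2 i)"

text \<open>Node \<open>i\<close> is moved onto the leaf \<open>x\<close> visited just before it. Neither position is a prefix
  of the other, so the two replacements do not interfere.\<close>

definition move :: "nat \<Rightarrow> 's trm \<Rightarrow> 's trm \<Rightarrow> bool" where
  "move i t1 t2 \<longleftrightarrow> i \<in> {1..deg t1} \<and>
     (\<exists>k x. Suc k < length (preorder t1) \<and>
        preorder t1 ! k = x \<and> subterm t1 x = Leaf \<and> preorder t1 ! Suc k = node t1 i \<and>
        t2 = replace (replace t1 (node t1 i) Leaf) x (subterm t1 (node t1 i)))"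

definition step :: "'s trm \<Rightarrow> 's trm \<Rightarrow> bool" where
  "step t1 t2 \<longleftrightarrow> (\<exists>i\<ge>1. move i t1 t2)"

text \<open>Triples of integers are ordered lexicographically by \<^theory>\<open>HOL-Library.Product_Lexorder\<close>.
  The labeling is only specified on pairs related by \<^const>\<open>step\<close>.\<close>

definition edge_label :: "'s trm \<Rightarrow> 's trm \<Rightarrow> int \<times> int \<times> int" where
  "edge_label t1 t2 = (THE l. step t1 t2 \<and>
     (\<exists>i1 j1 i. (i1, j1, i) \<in> edges t1 - edges t2 \<and> l = (int i, int i1, - int j1)))"

definition covered_by :: "'a set \<Rightarrow> ('a \<Rightarrow> 'a \<Rightarrow> bool) \<Rightarrow> 'a \<Rightarrow> 'a \<Rightarrow> bool" where
  "covered_by A le x y \<longleftrightarrow> x \<in> A \<and> y \<in> A \<and> le x y \<and> x \<noteq> y \<and>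
     (\<forall>z\<in>A. le x z \<and> le z y \<longrightarrow> z = x \<or> z = y)"

definition saturated_chain :: "'a set \<Rightarrow> ('a \<Rightarrow> 'a \<Rightarrow> bool) \<Rightarrow> 'a \<Rightarrow> 'a \<Rightarrow> 'a list \<Rightarrow> bool" where
  "saturated_chain A le x y c \<longleftrightarrow> c \<noteq> [] \<and> set c \<subseteq> A \<and> hd c = x \<and> last c = y \<and>
     successively (covered_by A le) c"

definition label_word :: "('a \<Rightarrow> 'a \<Rightarrow> 'l) \<Rightarrow> 'a list \<Rightarrow> 'l list" where
  "label_word lab c = map2 lab (butlast c) (tl c)"

definition label_increasing :: "('a \<Rightarrow> 'a \<Rightarrow> 'l::order) \<Rightarrow> 'a list \<Rightarrow> bool" where
  "label_increasing lab c \<longleftrightarrow> sorted_wrt (<) (label_word lab c)"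

definition label_weakly_decreasing :: "('a \<Rightarrow> 'a \<Rightarrow> 'l::order) \<Rightarrow> 'a list \<Rightarrow> bool" where
  "label_weakly_decreasing lab c \<longleftrightarrow> sorted_wrt (\<ge>) (label_word lab c)"

definition label_smaller :: "('a \<Rightarrow> 'a \<Rightarrow> 'l::order) \<Rightarrow> 'a list \<Rightarrow> 'a list \<Rightarrow> bool" where
  "label_smaller lab c c' \<longleftrightarrow> (label_word lab c, label_word lab c') \<in> lexord {(u, v). u < v}"

definition EL_labeling :: "'a set \<Rightarrow> ('a \<Rightarrow> 'a \<Rightarrow> bool) \<Rightarrow> ('a \<Rightarrow> 'a \<Rightarrow> 'l::order) \<Rightarrow> bool" where
  "EL_labeling A le lab \<longleftrightarrow> (\<forall>x\<in>A. \<forall>y\<in>A. le x y \<longrightarrow>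
     (\<exists>!c. saturated_chain A le x y c \<and> label_increasing lab c) \<and>
     (\<forall>c c'. saturated_chain A le x y c \<and> label_increasing lab c \<and>
        saturated_chain A le x y c' \<and> c' \<noteq> c \<longrightarrow> label_smaller lab c c'))"

end

theory Submission
  imports Defs "HOL-Library.Sublist"
begin

text \<open>
  A term with a given decoration word is determined by the slots (parent, child number) of its
  internal nodes, and ordering slots by parent and then by decreasing child number turns
  \<^const>\<open>term_le\<close> into a componentwise order. Reading a term in preorder amounts to keeping a stack
  of open slots with decreasing keys: node \<open>i\<close> takes one of them, those above it become leaves, and
  the children of \<open>i\<close> are pushed. A move at \<open>i\<close> raises the slot of \<open>i\<close> to the next higher one on
  the stack and changes no other slot, and its label is \<open>i\<close> together with the key of the old slot.
  If \<open>t \<preceq> u\<close> and \<open>i\<close> is the first node with different slots, the slot of \<open>i\<close> in \<open>u\<close> is also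
  available in \<open>t\<close>, so \<open>i\<close> can be moved without leaving the interval.

  Every chain from \<open>t\<close> to \<open>u\<close> contains, for each node \<open>i\<close> where they differ, the label of the first
  move of \<open>i\<close>, and it moves only such nodes. Hence an increasing chain always moves the first
  differing node and a weakly decreasing chain always moves the last one, which determines both.
\<close>

subsection \<open>Posets whose covers raise one coordinate\<close>

text \<open>In the application \<open>cls\<close> is the decoration word and \<open>crd\<close>
  lists the slot keys. A label pairs the raised index with the old value there, so repeated moves at
  one index have increasing labels. Moves come only from \<open>mv_ex\<close>, at the first
  differing coordinate.\<close>

locale raising_system =
  fixes A :: "'a set" and le :: "'a \<Rightarrow> 'a \<Rightarrow> bool" and cls :: "'a \<Rightarrow> 'c"
    and crd :: "'a \<Rightarrow> nat \<Rightarrow> 'b::linorder" and mv :: "nat \<Rightarrow> 'a \<Rightarrow> 'a \<Rightarrow> bool"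
    and lab :: "'a \<Rightarrow> 'a \<Rightarrow> int \<times> 'b"
  assumes le_iff: "x \<in> A \<Longrightarrow> y \<in> A \<Longrightarrow> le x y \<longleftrightarrow> cls x = cls y \<and> crd x \<le> crd y"
    and crd_inj: "x \<in> A \<Longrightarrow> y \<in> A \<Longrightarrow> cls x = cls y \<Longrightarrow> crd x = crd y \<Longrightarrow> x = y"
    and finite_cls: "x \<in> A \<Longrightarrow> finite {y \<in> A. cls y = cls x}"
    and mv_closed: "x \<in> A \<Longrightarrow> mv i x y \<Longrightarrow> y \<in> A"
    and mv_cls: "x \<in> A \<Longrightarrow> mv i x y \<Longrightarrow> cls y = cls x"
    and mv_crd: "x \<in> A \<Longrightarrow> mv i x y \<Longrightarrow> \<exists>v>crd x i. crd y = (crd x)(i := v)"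
    and mv_unique: "x \<in> A \<Longrightarrow> mv i x y \<Longrightarrow> mv i x y' \<Longrightarrow> y = y'"
    and mv_ex: "x \<in> A \<Longrightarrow> z \<in> A \<Longrightarrow> le x z \<Longrightarrow> crd x i < crd z i \<Longrightarrow>
      (\<And>m. m < i \<Longrightarrow> crd x m = crd z m) \<Longrightarrow> \<exists>y. mv i x y \<and> crd y i \<le> crd z i"
    and lab_mv: "x \<in> A \<Longrightarrow> mv i x y \<Longrightarrow> lab x y = (int i, crd x i)"
begin

abbreviation chain :: "'a \<Rightarrow> 'a \<Rightarrow> 'a list \<Rightarrow> bool" where
  "chain \<equiv> saturated_chain A le"

abbreviation cov :: "'a \<Rightarrow> 'a \<Rightarrow> bool" where
  "cov \<equiv> covered_by A le"

lemma mv_le: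
  assumes "x \<in> A" "mv i x y"
  shows "le x y \<and> x \<noteq> y"
proof -
  obtain v where v: "crd x i < v" "crd y = (crd x)(i := v)"
    using mv_crd[OF assms] by blast
  then have "crd x \<noteq> crd y"
    by (metis fun_upd_same less_irrefl)
  then show ?thesis
    using v assms mv_closed[OF assms] mv_cls[OF assms] by (auto simp: le_iff le_fun_def)
qed

lemma le_trans': "x \<in> A \<Longrightarrow> y \<in> A \<Longrightarrow> z \<in> A \<Longrightarrow> le x y \<Longrightarrow> le y z \<Longrightarrow> le x z"
  by (auto simp: le_iff)

lemma le_antisym: "x \<in> A \<Longrightarrow> y \<in> A \<Longrightarrow> le x y \<Longrightarrow> le y x \<Longrightarrow> x = y"
  by (auto simp: le_iff intro!: crd_inj)

text \<open>At the first differing coordinate \<open>x\<close> is strictly below \<open>z\<close>,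
  so \<open>mv_ex\<close> applies; the result stays below \<open>z\<close> because no other
  coordinate changes.\<close>

lemma least_mv:
  assumes "x \<in> A" "z \<in> A" "le x z" "x \<noteq> z"
  obtains i y where "mv i x y" "le y z" "crd x i < crd z i" "\<And>m. crd x m \<noteq> crd z m \<Longrightarrow> i \<le> m"
proof -
  define i where "i = (LEAST i. crd x i \<noteq> crd z i)"
  have "\<exists>i. crd x i \<noteq> crd z i"
    using assms crd_inj[of x z] by (auto simp: le_iff)
  then have ne: "crd x i \<noteq> crd z i"
    unfolding i_def by (rule LeastI_ex)
  have least: "i \<le> m" if "crd x m \<noteq> crd z m" for m
    unfolding i_def using that by (rule Least_le)
  have lt: "crd x i < crd z i"
    using ne assms by (auto simp: le_iff le_fun_def order.strict_iff_order)
  have eq: "crd x m = crd z m" if "m < i" for m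
    using least[of m] that by force
  obtain y where y: "mv i x y" "crd y i \<le> crd z i"
    using mv_ex[OF assms(1-3) lt eq] by blast
  have "le y z"
    using assms y mv_crd[OF assms(1) y(1)] mv_closed[OF assms(1) y(1)] mv_cls[OF assms(1) y(1)]
    by (auto simp: le_iff le_fun_def)
  then show ?thesis
    using that y(1) lt least by blast
qed

text \<open>A move from \<open>x\<close> that stays below a cover of \<open>x\<close> must reach it.
  Conversely, an element between the ends of a move at \<open>i\<close> can differ from the lower
  end only at \<open>i\<close>, so \<open>least_mv\<close> yields that same move again.\<close>

lemma cov_iff_mv:
  assumes "x \<in> A"
  shows "cov x y \<longleftrightarrow> (\<exists>i. mv i x y)"
proof
  assume c: "cov x y"
  then obtain i y' where y': "mv i x y'" "le y' y"
    using least_mv[of x y] unfolding covered_by_def by metis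
  then have "y' = y"
    using c mv_le[OF assms y'(1)] mv_closed[OF assms y'(1)] by (auto simp: covered_by_def)
  then show "\<exists>i. mv i x y"
    using y' by blast
next
  assume "\<exists>i. mv i x y"
  then obtain i where i: "mv i x y"
    by blast
  then have y: "y \<in> A"
    using assms mv_closed by blast
  have "z = y" if z: "z \<in> A" "le x z" "le z y" "z \<noteq> x" for z
  proof -
    obtain j y' where y': "mv j x y'" "le y' z" "crd x j < crd z j"
      using least_mv[of x z] assms z by metis
    have "crd z j \<le> crd y j"
      using z y by (auto simp: le_iff le_fun_def)
    then have "j = i"
      using y'(3) mv_crd[OF assms i] by (auto split: if_splits)
    then have "y' = y"
      using mv_unique assms y'(1) i by blast
    then show ?thesis
      using y' z y le_antisym by blast
  qed
  then show "cov x y"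
    using mv_le[OF assms i] assms y by (auto simp: covered_by_def)
qed

section \<open>Saturated chains and their label words\<close>

lemma chain_Nil [simp]: "\<not> chain x z []"
  by (simp add: saturated_chain_def)

lemma chain_single [simp]: "chain x z [y] \<longleftrightarrow> y = x \<and> y = z \<and> y \<in> A"
  by (auto simp: saturated_chain_def)

lemma chain_Cons:
  "chain x z (x' # y # c) \<longleftrightarrow> x' = x \<and> x \<in> A \<and> cov x y \<and> chain y z (y # c)"
  by (auto simp: saturated_chain_def)

lemma label_word_single [simp]: "label_word lab [x] = []"
  by (simp add: label_word_def)

lemma label_word_Cons [simp]: "label_word lab (x # y # c) = lab x y # label_word lab (y # c)"
  by (simp add: label_word_def)

lemma chain_le: "chain x z c \<Longrightarrow> x \<in> A \<and> z \<in> A \<and> le x z"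
proof (induction c arbitrary: x)
  case (Cons x' c)
  show ?case
  proof (cases c)
    case Nil
    then show ?thesis
      using Cons.prems by (auto simp: le_iff)
  next
    case (Cons y c')
    then have "x \<in> A" "cov x y" "chain y z c"
      using Cons.prems by (auto simp: chain_Cons)
    then show ?thesis
      using Cons.IH[of y] le_trans'[of x y z] by (auto simp: covered_by_def)
  qed
qed simp

lemma chain_cases:
  assumes "chain x z c"
  obtains "x = z" "c = [x]"
  | i y c' where "x \<noteq> z" "c = x # y # c'" "mv i x y" "chain y z (y # c')" "crd x i < crd z i"
\<comment> \<open>The rule is borrowed for its split into empty, singleton and longer lists.\<close>
proof (cases c rule: remdups_adj.cases)
  case (3 x' y c')
  then have c: "x' = x" "x \<in> A" "cov x y" "chain y z (y # c')"
    using assms by (auto simp: chain_Cons)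
  then obtain i where i: "mv i x y"
    using cov_iff_mv by blast
  have y: "y \<in> A" "z \<in> A" "le y z"
    using chain_le c(4) by auto
  have lt: "crd x i < crd y i"
    using mv_crd[OF c(2) i] by auto
  also have "\<dots> \<le> crd z i"
    using y by (auto simp: le_iff le_fun_def)
  finally show ?thesis
    using that(2) 3 c i by (metis less_irrefl)
qed (use assms that in auto)

text \<open>Coordinates never decrease along a chain, and a label shows a value that is about to
  grow.\<close>

lemma label_word_bounds:
  assumes "chain x z c" "l \<in> set (label_word lab c)"
  shows "\<exists>i v. l = (int i, v) \<and> crd x i \<le> v \<and> v < crd z i"
  using assms
proof (induction c arbitrary: x)
  case (Cons x' c)
  from Cons.prems(1) show ?case
  proof (cases rule: chain_cases)
    case 1
    then show ?thesis
      using Cons.prems by simp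
  next
    case (2 i y c')
    have x: "x \<in> A"
      using Cons.prems chain_le by blast
    then have "crd x m \<le> crd y m" for m
      using mv_crd[OF x 2(3)] by auto
    moreover have "l = (int i, crd x i) \<or> l \<in> set (label_word lab c)"
      using Cons.prems 2 lab_mv[OF x 2(3)] by auto
    ultimately show ?thesis
      using Cons.IH[of y] 2 by (metis list.inject order.trans order_refl)
  qed
qed simp

text \<open>Coordinate \<open>i\<close> keeps its value from \<open>x\<close> until its first move,
  which must occur since the ends differ there.\<close>

lemma label_word_hits:
  assumes "chain x z c" "crd x i \<noteq> crd z i"
  shows "(int i, crd x i) \<in> set (label_word lab c)"
  using assms
proof (induction c arbitrary: x)
  case (Cons x' c)
  from Cons.prems(1) show ?case
  proof (cases rule: chain_cases)
    case 1
    then show ?thesis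
      using Cons.prems by simp
  next
    case (2 j y c')
    have x: "x \<in> A"
      using Cons.prems chain_le by blast
    show ?thesis
    proof (cases "j = i")
      case True
      then show ?thesis
        using 2 lab_mv[OF x 2(3)] by auto
    next
      case False
      then have "crd y i = crd x i"
        using mv_crd[OF x 2(3)] by auto
      then show ?thesis
        using Cons.IH[of y] Cons.prems 2 by auto
    qed
  qed
qed simp

text \<open>Always moving the first differing coordinate gives increasing labels. The process ends
  because the set of elements above the current one lies in a finite class and shrinks.\<close>

lemma increasing_chain_exists:
  assumes "x \<in> A" "z \<in> A" "le x z"
  shows "\<exists>c. chain x z c \<and> label_increasing lab c"
  using assms
proof (induction "card {y \<in> A. le x y}" arbitrary: x rule: less_induct)
  case less
  show ?case
  proof (cases "x = z")
    case True
    then show ?thesis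
      using less.prems by (auto intro!: exI[of _ "[x]"] simp: label_increasing_def)
  next
    case False
    then obtain i y where y: "mv i x y" "le y z" "crd x i < crd z i"
        "\<And>m. crd x m \<noteq> crd z m \<Longrightarrow> i \<le> m"
      using least_mv less.prems by metis
    note x = less.prems(1)
    have yA: "y \<in> A" and xy: "le x y" "x \<noteq> y"
      using mv_closed[OF x y(1)] mv_le[OF x y(1)] by auto
    have "finite {y \<in> A. le x y}"
      using finite_cls[OF x] by (rule rev_finite_subset) (auto simp: le_iff x)
    moreover have "{w \<in> A. le y w} \<subset> {w \<in> A. le x w}"
    proof -
      have "x \<in> {w \<in> A. le x w} - {w \<in> A. le y w}"
        using x yA xy le_antisym[of x y] by (auto simp: le_iff)
      moreover have "{w \<in> A. le y w} \<subseteq> {w \<in> A. le x w}"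
        using x yA xy le_trans'[of x y] by blast
      ultimately show ?thesis
        by blast
    qed
    ultimately have "card {w \<in> A. le y w} < card {w \<in> A. le x w}"
      by (rule psubset_card_mono)
    then obtain c where c: "chain y z c" "label_increasing lab c"
      using less.hyps[of y] yA less.prems(2) y(2) by blast
    then obtain c' where c': "c = y # c'"
      by (cases c) (auto simp: saturated_chain_def)
    \<comment> \<open>Later labels have an index where \<open>x\<close> and \<open>z\<close> differ,
      hence at least \<open>i\<close>; at index \<open>i\<close> itself the value has already been
      raised.\<close>
    have "lab x y < l" if l: "l \<in> set (label_word lab c)" for l
    proof -
      obtain j v where j: "l = (int j, v)" "crd y j \<le> v" "v < crd z j"
        using label_word_bounds[OF c(1) l] by blast
      moreover have "crd x j \<le> crd y j"
        using x yA xy by (auto simp: le_iff le_fun_def)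
      ultimately have "i \<le> j"
        using y(4)[of j] by force
      then show ?thesis
        using j mv_crd[OF x y(1)] lab_mv[OF x y(1)] by (cases "i = j") auto
    qed
    then have "label_increasing lab (x # c)"
      using c(2) c' by (auto simp: label_increasing_def)
    moreover have "chain x z (x # c)"
      using c c' x y(1) cov_iff_mv by (auto simp: chain_Cons)
    ultimately show ?thesis
      by blast
  qed
qed

text \<open>Where the chains part, by moves at \<open>i\<close> and \<open>i'\<close>, the
  increasing chain still has to contain the label of the first move at \<open>i'\<close>. There it
  comes after the label of \<open>i\<close> and so exceeds it.\<close>

lemma increasing_chain_smaller:
  assumes "chain x z c" "label_increasing lab c" "chain x z c'" "c' \<noteq> c"
  shows "label_smaller lab c c'"
  using assms
proof (induction c arbitrary: x c')
  case (Cons x' c)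
  from Cons.prems(1) show ?case
  proof (cases rule: chain_cases)
    case 1
    then show ?thesis
      using Cons.prems(3,4) by (auto elim: chain_cases)
  next
    case c: (2 i y d)
    note x = chain_le[OF Cons.prems(1), THEN conjunct1]
    from Cons.prems(3) show ?thesis
    proof (cases rule: chain_cases)
      case 1
      then show ?thesis
        using c by simp
    next
      case c': (2 i' y' d')
      show ?thesis
      proof (cases "i = i'")
        case True
        then have "y' = y"
          using mv_unique c c' x by blast
        then show ?thesis
          using Cons.IH[of y "y # d'"] Cons.prems c c'
          by (auto simp: label_smaller_def label_increasing_def)
      next
        case False
        have "(int i', crd x i') \<in> set (label_word lab (x # y # d))"
          using label_word_hits[OF Cons.prems(1), of i'] c c' by auto
        then have "(int i, crd x i) < (int i', crd x i')"
          using Cons.prems(2) c False lab_mv[OF x c(3)] by (auto simp: label_increasing_def)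
        then show ?thesis
          using c c' lab_mv[OF x c(3)] lab_mv[OF x c'(3)] by (auto simp: label_smaller_def)
      qed
    qed
  qed
qed simp

text \<open>Two distinct increasing chains would each be lexicographically smaller than the
  other.\<close>

lemma EL: "EL_labeling A le lab"
proof -
  have "c = c'"
    if "chain x z c" "label_increasing lab c" "chain x z c'" "label_increasing lab c'" for x z c c'
  proof (rule ccontr)
    assume "c \<noteq> c'"
    then have "label_smaller lab c c'" "label_smaller lab c' c"
      using that increasing_chain_smaller by auto
    then show False
      unfolding label_smaller_def
      by (metis (mono_tags, lifting) asymI asymD case_prodD less_asym lexord_asym
          mem_Collect_eq)
  qed
  then show ?thesis
    unfolding EL_labeling_def using increasing_chain_exists increasing_chain_smaller by metis
qed

lemma weakly_decreasing_unique:
  assumes "chain x z c" "label_weakly_decreasing lab c"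
    and "chain x z c'" "label_weakly_decreasing lab c'"
  shows "c = c'"
  using assms
proof (induction c arbitrary: x c')
  case (Cons x' c)
  \<comment> \<open>The first label of a weakly decreasing chain bounds the label that
    \<open>label_word_hits\<close> gives for each differing coordinate \<open>m\<close>, so the
    first move is at the last of these.\<close>
  have max: "m \<le> i" if "chain x z (x # y # d)" "label_weakly_decreasing lab (x # y # d)"
    "mv i x y" "crd x m \<noteq> crd z m" for i m y d
  proof -
    have "(int m, crd x m) \<in> set (label_word lab (x # y # d))"
      using label_word_hits that by blast
    then have "(int m, crd x m) \<le> (int i, crd x i)"
      using that(2) lab_mv[OF _ that(3)] chain_le[OF that(1)]
      by (auto simp: label_weakly_decreasing_def)
    then show ?thesis
      by auto
  qed
  from Cons.prems(1) show ?case
  proof (cases rule: chain_cases)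
    case 1
    then show ?thesis
      using Cons.prems(3) by (auto elim: chain_cases)
  next
    case c: (2 i y d)
    note x = chain_le[OF Cons.prems(1), THEN conjunct1]
    from Cons.prems(3) show ?thesis
    proof (cases rule: chain_cases)
      case 1
      then show ?thesis
        using c by simp
    next
      case c': (2 i' y' d')
      have "i = i'"
        using max[of y d i i'] max[of y' d' i' i] Cons.prems c c' by (force intro: order.antisym)
      then have "y' = y"
        using mv_unique c c' x by blast
      then show ?thesis
        using Cons.IH[of y "y # d'"] Cons.prems c c'
        by (auto simp: label_weakly_decreasing_def)
    qed
  qed
qed simp

end

subsection \<open>Preorder traversal with a stack of slots\<close>

text \<open>Preorder traversal is run on a stack of pending subterms. A pending subterm carries its
  position and its slot \<open>(k, j)\<close>: it is the \<open>j\<close>-th child of the internal node number \<open>k\<close>.\<close>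

type_synonym 's entry = "(nat list \<times> nat \<times> nat) \<times> 's trm"

abbreviation pos :: "'s entry \<Rightarrow> nat list" where
  "pos e \<equiv> fst (fst e)"

abbreviation slot :: "'s entry \<Rightarrow> nat \<times> nat" where
  "slot e \<equiv> snd (fst e)"

abbreviation sym :: "'s entry \<Rightarrow> 's" where
  "sym e \<equiv> root (snd e)"

text \<open>Slots in this order follow \<^const>\<open>cnc\<close>, and \<open>(int i, key s)\<close> is the label of an edge
  removed at node \<open>i\<close> in slot \<open>s\<close>.\<close>

definition key :: "nat \<times> nat \<Rightarrow> int \<times> int" where
  "key s = (int (fst s), - int (snd s))"

definition kids :: "nat \<Rightarrow> nat list \<Rightarrow> 's trm list \<Rightarrow> 's entry list" where
  "kids m q ts = map (\<lambda>(j, t). ((q @ [j], m, j), t)) (enumerate 1 ts)"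

text \<open>\<open>m\<close> is the number that the next internal node will receive.\<close>

function visit :: "nat \<Rightarrow> 's entry list \<Rightarrow> 's entry list" where
  Nil: "visit m [] = []"
| Leaf: "visit m ((l, Leaf) # st) = (l, Leaf) # visit m st"
| Node: "visit m ((l, Node s ts) # st) = (l, Node s ts) # visit (Suc m) (kids m (fst l) ts @ st)"
  by pat_completeness auto

lemma snd_kids [simp]: "map snd (kids m q ts) = ts"
  by (rule nth_equalityI) (auto simp: kids_def nth_enumerate_eq)

lemma length_kids [simp]: "length (kids m q ts) = length ts"
  by (simp add: kids_def)

lemma nth_kids: "j < length ts \<Longrightarrow> kids m q ts ! j = ((q @ [Suc j], m, Suc j), ts ! j)"
  by (simp add: kids_def nth_enumerate_eq)

termination visit
\<comment> \<open>Each pending subterm counts one more than its size, so that passing a leaf also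
  decreases the measure.\<close>
proof (relation "measure (\<lambda>(m, st). sum_list (map (\<lambda>t. Suc (size t)) (map snd st)))")
  fix m :: nat and l :: "nat list \<times> nat \<times> nat" and s :: 'a and ts :: "'a trm list" and st :: "'a entry list"
  have "sum_list (map (\<lambda>t. Suc (size t)) ts) < Suc (size (Node s ts))"
    by (induction ts) auto
  then show "((Suc m, kids m (fst l) ts @ st), m, (l, Node s ts) # st)
      \<in> measure (\<lambda>(m, st). sum_list (map (\<lambda>t. Suc (size t)) (map snd st)))"
    by (simp del: map_map)
qed auto

text \<open>Counting from 0, entry \<open>i\<close> is the internal node with number
  \<open>m + i\<close>.\<close>

definition inner :: "nat \<Rightarrow> 's entry list \<Rightarrow> 's entry list" where
  "inner m st = filter (\<lambda>e. snd e \<noteq> Leaf) (visit m st)"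

lemma inner_simps [simp]:
  "inner m [] = []"
  "inner m ((l, Leaf) # st) = inner m st"
  "inner m ((l, Node s ts) # st) = (l, Node s ts) # inner (Suc m) (kids m (fst l) ts @ st)"
  by (simp_all add: inner_def)

text \<open>The top of the stack is exempt from the bound on parents, because the root has the
  conventional slot \<open>(1, 0)\<close> although its own number is \<open>1\<close>.\<close>

definition valid_stack :: "nat \<Rightarrow> 's entry list \<Rightarrow> bool" where
  "valid_stack m st \<longleftrightarrow>
     sorted_wrt (\<lambda>a b. key (slot b) < key (slot a) \<and> pos a \<parallel> pos b) st \<and>
     (\<forall>e\<in>set (tl st). fst (slot e) < m)"

lemma set_kids: "e \<in> set (kids m q ts) \<longleftrightarrow> (\<exists>j<length ts. e = ((q @ [Suc j], m, Suc j), ts ! j))"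
  by (auto simp: in_set_conv_nth nth_kids)

lemma valid_stack_Leaf: "valid_stack m (e # st) \<Longrightarrow> valid_stack m st"
  by (cases st) (auto simp: valid_stack_def)

lemma valid_stack_Node:
  assumes "valid_stack m ((l, t) # st)"
  shows "valid_stack (Suc m) (kids m (fst l) ts @ st)"
proof -
  have "sorted_wrt (\<lambda>a b. key (slot b) < key (slot a) \<and> pos a \<parallel> pos b) (kids m (fst l) ts)"
    by (auto simp: sorted_wrt_iff_nth_less nth_kids key_def)
  moreover have "key (slot b) < key (slot a) \<and> pos a \<parallel> pos b"
    if ab: "a \<in> set (kids m (fst l) ts)" "b \<in> set st" for a b
  proof -
    \<comment> \<open>Only the popped entry is exempt from the bound, so the entries that remain
      have parents below \<open>m\<close>, the parent of the new children.\<close>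
    have "fst l \<parallel> pos b" "fst (slot b) < m"
      using assms ab by (auto simp: valid_stack_def)
    moreover obtain j where "slot a = (m, j)" "prefix (fst l) (pos a)"
      using ab by (auto simp: set_kids)
    ultimately show ?thesis
      by (metis (no_types, lifting) fst_conv key_def less_prod_simp of_nat_less_iff parallelD1
          parallelD2 parallelI prefix_order.trans prefix_same_cases)
  qed
  moreover have "fst (slot e) < Suc m" if "e \<in> set (kids m (fst l) ts @ st)" for e
    using that assms by (fastforce simp: valid_stack_def set_kids)
  then have "\<forall>e\<in>set (tl (kids m (fst l) ts @ st)). fst (slot e) < Suc m"
    by (metis list.sel(2) list.set_sel(2))
  ultimately show ?thesis
    using assms unfolding valid_stack_def by (simp add: sorted_wrt_append)
qed

lemma visit_origin:
  assumes "e \<in> set (visit m st)"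
  shows "\<exists>e0\<in>set st. \<exists>p. pos e = pos e0 @ p \<and> subterm (snd e0) p = snd e"
  using assms
proof (induction m st rule: visit.induct)
  case (3 m l s ts st)
  show ?case
  proof (cases "e = (l, Node s ts)")
    case False
    then have "e \<in> set (visit (Suc m) (kids m (fst l) ts @ st))"
      using 3(2) by auto
    from 3(1)[OF this] obtain e0 p where
      e0: "e0 \<in> set (kids m (fst l) ts @ st)" "pos e = pos e0 @ p" "subterm (snd e0) p = snd e"
      by blast
    show ?thesis
    proof (cases "e0 \<in> set st")
      case False
      then obtain j where "j < length ts" "e0 = ((fst l @ [Suc j], m, Suc j), ts ! j)"
        using e0 by (auto simp: set_kids)
      then show ?thesis
        using e0 by (auto intro!: exI[of _ "Suc j # p"])
    qed (use e0 in auto)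
  qed auto
qed auto

lemma visit_origin_prefix: "e \<in> set (visit m st) \<Longrightarrow> \<exists>e0\<in>set st. prefix (pos e0) (pos e)"
  using visit_origin by (metis prefixI)

lemma not_prefix_of_tail:
  assumes "valid_stack m (e # st)" "prefix (pos e0) x" "e0 \<in> set st"
  shows "\<not> prefix (pos e) x"
proof -
  have "pos e \<parallel> pos e0"
    using assms by (auto simp: valid_stack_def)
  then show ?thesis
    using assms(2) prefix_same_cases by blast
qed

lemma distinct_visit:
  assumes "valid_stack m st"
  shows "distinct (map pos (visit m st))"
  using assms
proof (induction m st rule: visit.induct)
  case (2 m l st)
  have "fst l \<noteq> pos e" if "e \<in> set (visit m st)" for e
    using visit_origin_prefix[OF that] not_prefix_of_tail[OF 2(2)] by fastforce
  then show ?case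
    using 2(1)[OF valid_stack_Leaf[OF 2(2)]] by auto
next
  case (3 m l s ts st)
  have "fst l \<noteq> pos e" if e: "e \<in> set (visit (Suc m) (kids m (fst l) ts @ st))" for e
  proof -
    obtain e0 where e0: "e0 \<in> set (kids m (fst l) ts @ st)" "prefix (pos e0) (pos e)"
      using visit_origin_prefix[OF e] by blast
    show ?thesis
    proof (cases "e0 \<in> set st")
      case True
      then show ?thesis
        using not_prefix_of_tail[OF 3(2) e0(2)] by auto
    next
      case False
      then show ?thesis
        using e0 by (auto simp: set_kids)
    qed
  qed
  then show ?case
    using 3(1)[OF valid_stack_Node[OF 3(2)]] by auto
qed auto

text \<open>Ties the stack traversal to the recursive \<open>preorder\<close>; the one-entry stack
  \<open>start t\<close> gives \<open>preorder_eq\<close>.\<close>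

lemma pos_visit: "map pos (visit m st) = concat (map (\<lambda>e. map ((@) (pos e)) (preorder (snd e))) st)"
proof (induction m st rule: visit.induct)
  case (3 m l s ts st)
  have "concat (map (\<lambda>e. map ((@) (pos e)) (preorder (snd e))) (kids m (fst l) ts)) =
      map ((@) (fst l)) (concat (map (\<lambda>(j, ps). map ((#) j) ps) (enumerate 1 (map preorder ts))))"
    unfolding map_concat map_map
    by (rule arg_cong[where f = concat], rule nth_equalityI)
      (auto simp: nth_kids nth_enumerate_eq)
  then show ?case
    using 3 by simp
qed auto

text \<open>Moving a subterm changes the positions of its nodes but not their numbers; this carries
  slots and symbols across that change.\<close>

lemma inner_cong:
  assumes "map slot st = map slot st'" "map snd st = map snd st'"
  shows "map slot (inner m st) = map slot (inner m st') \<and> map sym (inner m st) = map sym (inner m st')"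
  using assms
proof (induction m st arbitrary: st' rule: visit.induct)
  case (2 m l st)
  then obtain l' st0 where "st' = (l', Leaf) # st0"
    by (cases st') (auto simp: map_eq_Cons_conv)
  then show ?case
    using 2 by simp
next
  case (3 m l s ts st)
  then obtain l' st0 where st': "st' = (l', Node s ts) # st0"
    by (cases st') (auto simp: map_eq_Cons_conv)
  have "map slot (kids m (fst l) ts) = map slot (kids m (fst l') ts)"
    by (rule nth_equalityI) (auto simp: nth_kids)
  then show ?case
    using 3(1)[of "kids m (fst l') ts @ st0"] 3(2,3) st' by simp
qed auto

text \<open>Leaves receive no number. This removes the leaf that a detached subterm leaves
  behind.\<close>

lemma inner_drop_Leaf: "inner m (st @ (l, Leaf) # st') = inner m (st @ st')"
  by (induction m st rule: visit.induct) auto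

text \<open>Before the first internal node only leaves are popped, and nothing is pushed. The extra
  leaf on top ensures that this node has a predecessor.\<close>

lemma inner_hd:
  assumes "inner m st = e # es"
  shows "\<exists>k x'. Suc k < length (visit m ((x, Leaf) # st)) \<and> visit m ((x, Leaf) # st) ! k = (x', Leaf) \<and>
    visit m ((x, Leaf) # st) ! Suc k = e \<and> x' \<in> insert x (fst ` set st) \<and> e \<in> set st"
  using assms
proof (induction m st arbitrary: x rule: visit.induct)
  case (2 m l st)
  then obtain k x' where "Suc k < length (visit m ((l, Leaf) # st))"
    "visit m ((l, Leaf) # st) ! k = (x', Leaf)"
    "visit m ((l, Leaf) # st) ! Suc k = e" "x' \<in> insert l (fst ` set st)" "e \<in> set st"
    by (metis inner_simps(2))
  then show ?case
    by (intro exI[of _ "Suc k"] exI[of _ x']) auto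
next
  case (3 m l s ts st)
  then show ?case
    by (intro exI[of _ 0] exI[of _ x]) auto
qed auto

lemma inner_hd_less:
  assumes "inner m st = e # es" "valid_stack m (e0 # st)"
  shows "key (slot e) < key (slot e0)"
  using inner_hd[OF assms(1)] assms(2) by (fastforce simp: valid_stack_def)

text \<open>A visited entry was on the initial stack or was pushed by an earlier node, whose number
  its slot records.\<close>

lemma inner_parent:
  assumes "i < length (inner m st)" "fst (inner m st ! i) = (q, k, j)"
  shows "(q, k, j) \<in> fst ` set st \<or>
    m \<le> k \<and> k < m + i \<and> 1 \<le> j \<and> j \<le> length (children (snd (inner m st ! (k - m)))) \<and>
    q = pos (inner m st ! (k - m)) @ [j]"
  using assms
proof (induction m st arbitrary: i rule: visit.induct)
  case (3 m l s ts st)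
  show ?case
  proof (cases i)
    case (Suc i')
    then consider "(q, k, j) \<in> fst ` set (kids m (fst l) ts)" | "(q, k, j) \<in> fst ` set st"
      | "Suc m \<le> k \<and> k < Suc m + i' \<and> 1 \<le> j \<and>
          j \<le> length (children (snd (inner (Suc m) (kids m (fst l) ts @ st) ! (k - Suc m)))) \<and>
          q = pos (inner (Suc m) (kids m (fst l) ts @ st) ! (k - Suc m)) @ [j]"
      using 3(1)[of i'] 3(2,3) by auto
    then show ?thesis
    proof cases
      case 1
      then show ?thesis
        using Suc by (auto simp: set_kids)
    next
      case 3
      moreover have "k - m = Suc (k - Suc m)"
        using 3 by auto
      ultimately show ?thesis
        using Suc by auto
    qed auto
  qed (use 3 in auto)
qed auto

section \<open>Replacement at an absolute position, followed through the traversal\<close>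

definition graft :: "nat list \<Rightarrow> 's trm \<Rightarrow> 's entry \<Rightarrow> 's entry" where
  "graft z u e = (fst e, if prefix (pos e) z then replace (snd e) (drop (length (pos e)) z) u else snd e)"

lemma fst_graft [simp]: "fst (graft z u e) = fst e"
  by (simp add: graft_def)

lemma graft_not_prefix: "\<not> prefix (pos e) z \<Longrightarrow> graft z u e = e"
  by (simp add: graft_def)

text \<open>When \<open>z\<close> is not the position of the node itself, a replacement at
  \<open>z\<close> takes place inside a child or outside the node, so it commutes with popping the
  node and pushing its children.\<close>

lemma graft_Node:
  assumes "prefix (fst l) z \<Longrightarrow> \<exists>e\<in>set (kids m (fst l) ts). prefix (pos e) z"
  shows "\<exists>ts'. length ts' = length ts \<and> graft z u (l, Node s ts) = (l, Node s ts') \<and>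
    map (graft z u) (kids m (fst l) ts) = kids m (fst l) ts'"
proof (cases "prefix (fst l) z")
  case True
  then obtain j p where j: "j < length ts" "z = fst l @ Suc j # p"
    using assms by (auto simp: set_kids prefix_def)
  let ?ts' = "ts[j := replace (ts ! j) p u]"
  have "graft z u (l, Node s ts) = (l, Node s ?ts')"
    using j by (simp add: graft_def)
  moreover have "map (graft z u) (kids m (fst l) ts) = kids m (fst l) ?ts'"
    by (rule nth_equalityI) (use j in \<open>auto simp: nth_kids graft_def nth_list_update\<close>)
  ultimately show ?thesis
    by (intro exI[of _ ?ts']) auto
next
  case False
  then have "graft z u e = e" if "e \<in> set (kids m (fst l) ts)" for e
    using that append_prefixD by (intro graft_not_prefix) (force simp: set_kids)
  then show ?thesis
    using False by (intro exI[of _ ts]) (auto simp: graft_not_prefix map_idI)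
qed

text \<open>The traversals of the old and new term run in parallel until the leaf \<open>x\<close>
  is on top with the moved node right below it. There the node takes slot \<open>a\<close> and a
  leaf takes slot \<open>b\<close>; the stacks that follow agree in slots and symbols up to that
  leaf.\<close>

lemma visit_raise:
  assumes "valid_stack m st" "Suc k < length (visit m st)"
    and "visit m st ! k = ((x, a), Leaf)" "visit m st ! Suc k = ((y, b), Node s ts)"
    and "snd ` set st \<subseteq> terms S ar"
  defines "st' \<equiv> map (graft x (Node s ts)) (map (graft y Leaf) st)"
  shows "snd ` set st' \<subseteq> terms S ar \<and> (\<exists>i<length (inner m st). inner m st ! i = ((y, b), Node s ts) \<and>
    key b < key a \<and> map slot (inner m st') = (map slot (inner m st))[i := a] \<and>
    map sym (inner m st') = map sym (inner m st))"
  using assms(1-5) unfolding st'_def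
proof (induction m st arbitrary: k rule: visit.induct)
  case (2 m l st)
  show ?case
  proof (cases k)
    case 0
    have l: "l = (x, a)"
      using 2 0 by auto
    have "visit m st ! 0 = ((y, b), Node s ts)" "visit m st \<noteq> []"
      using 2 0 by auto
    then obtain st0 where st: "st = ((y, b), Node s ts) # st0"
      by (cases "(m, st)" rule: visit.cases) auto
    have par: "x \<parallel> y" "key b < key a"
      using 2(2) unfolding st l by (auto simp: valid_stack_def)
    have "\<not> prefix (pos e) x \<and> \<not> prefix (pos e) y" if "e \<in> set st0" for e
      using 2(2) that unfolding st l by (auto simp: valid_stack_def)
    then have id: "map (graft x (Node s ts)) (map (graft y Leaf) st0) = st0"
      by (auto simp: graft_not_prefix map_idI)
    have st': "map (graft x (Node s ts)) (map (graft y Leaf) ((l, Leaf) # st)) =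
        ((x, a), Node s ts) # ((y, b), Leaf) # st0"
      using par id unfolding st l by (simp add: graft_def parallelD1 parallelD2)
    \<comment> \<open>The pushed children have new positions but the same slots, since their parent
      keeps the number \<open>m\<close>.\<close>
    have "map slot (kids m x ts) = map slot (kids m y ts)"
      by (rule nth_equalityI) (auto simp: nth_kids)
    then have "map slot (kids m x ts @ st0) = map slot (kids m y ts @ st0)"
      "map snd (kids m x ts @ st0) = map snd (kids m y ts @ st0)"
      by auto
    note inner_cong[OF this, of "Suc m"]
    then show ?thesis
      using 2(6) par inner_drop_Leaf[of "Suc m" "kids m x ts" "(y, b)" st0] unfolding st'
      unfolding st l by (auto intro!: exI[of _ 0])
  next
    case (Suc k')
    have "visit m st ! k' = ((x, a), Leaf)" "visit m st ! Suc k' = ((y, b), Node s ts)"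
      "Suc k' < length (visit m st)"
      using 2(3-5) Suc by simp_all
    then have "((x, a), Leaf) \<in> set (visit m st)" "((y, b), Node s ts) \<in> set (visit m st)"
      by (metis Suc_lessD nth_mem)+
    moreover have "\<not> prefix (fst l) (pos e)" if "e \<in> set (visit m st)" for e
      using visit_origin_prefix[OF that] not_prefix_of_tail[OF 2(2)] by auto
    ultimately have "\<not> prefix (fst l) x" "\<not> prefix (fst l) y"
      by (metis fst_conv)+
    then show ?thesis
      using 2(1)[of k'] 2(2-6) Suc valid_stack_Leaf[OF 2(2)] by (auto simp: graft_not_prefix)
  qed
next
  case (3 m l s0 ts0 st)
  let ?v = "visit (Suc m) (kids m (fst l) ts0 @ st)"
  obtain k' where k: "k = Suc k'"
    using 3(4) by (cases k) auto
  have "?v ! k' = ((x, a), Leaf)" "?v ! Suc k' = ((y, b), Node s ts)" "Suc k' < length ?v"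
    using 3(3-5) k by simp_all
  then have "((x, a), Leaf) \<in> set ?v" "((y, b), Node s ts) \<in> set ?v"
    by (metis Suc_lessD nth_mem)+
  from this[THEN imageI[where f = "\<lambda>e. pos e"]]
  have xy: "x \<in> pos ` set ?v" "y \<in> pos ` set ?v"
    by (simp_all only: fst_conv)
  \<comment> \<open>\<open>x\<close> and \<open>y\<close> are visited after this node, and entries
    further down the stack have positions parallel to it. So if they extend its position they lie
    inside a child, as \<open>graft_Node\<close> requires.\<close>
  have kid: "\<exists>e\<in>set (kids m (fst l) ts0). prefix (pos e) z"
    if z: "prefix (fst l) z" "z \<in> pos ` set ?v" for z
  proof -
    obtain e' where "e' \<in> set ?v" "z = pos e'"
      using z(2) by blast
    then obtain e where "e \<in> set (kids m (fst l) ts0 @ st)" "prefix (pos e) z"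
      using visit_origin_prefix by metis
    then show ?thesis
      using z(1) not_prefix_of_tail[OF 3(2)] by fastforce
  qed
  obtain ts1 where ts1: "length ts1 = length ts0" "graft y Leaf (l, Node s0 ts0) = (l, Node s0 ts1)"
    "map (graft y Leaf) (kids m (fst l) ts0) = kids m (fst l) ts1"
    using graft_Node[OF kid] xy by metis
  have "\<exists>e\<in>set (kids m (fst l) ts1). prefix (pos e) x" if "prefix (fst l) x"
    using kid[OF that xy(1)] ts1(1) by (fastforce simp: Bex_def set_kids)
  from graft_Node[OF this] obtain ts2 where ts2: "length ts2 = length ts1"
    "graft x (Node s ts) (l, Node s0 ts1) = (l, Node s0 ts2)"
    "map (graft x (Node s ts)) (kids m (fst l) ts1) = kids m (fst l) ts2"
    by metis
  let ?g = "\<lambda>st. map (graft x (Node s ts)) (map (graft y Leaf) st)"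
  have g: "?g (kids m (fst l) ts0 @ st) = kids m (fst l) ts2 @ ?g st"
    "?g ((l, Node s0 ts0) # st) = (l, Node s0 ts2) # ?g st"
    using ts1 ts2 by auto
  have "Node s0 ts0 \<in> terms S ar"
    using 3(6) by simp
  then have wf: "s0 \<in> S" "length ts0 = ar s0" "set ts0 \<subseteq> terms S ar"
    by (cases; auto)+
  have snd_img: "snd ` set (kids m (fst l) us) = set us" for us :: "'a trm list"
    by (metis list.set_map snd_kids)
  have "snd ` set (kids m (fst l) ts0 @ st) \<subseteq> terms S ar"
    using 3(6) wf by (simp add: image_Un snd_img)
  from 3(1)[OF valid_stack_Node[OF 3(2)] _ _ _ this, of k'] 3(3-5) k
  have IH: "snd ` set (kids m (fst l) ts2 @ ?g st) \<subseteq> terms S ar"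
    "\<exists>i<length (inner (Suc m) (kids m (fst l) ts0 @ st)).
       inner (Suc m) (kids m (fst l) ts0 @ st) ! i = ((y, b), Node s ts) \<and> key b < key a \<and>
       map slot (inner (Suc m) (kids m (fst l) ts2 @ ?g st)) =
         (map slot (inner (Suc m) (kids m (fst l) ts0 @ st)))[i := a] \<and>
       map sym (inner (Suc m) (kids m (fst l) ts2 @ ?g st)) =
         map sym (inner (Suc m) (kids m (fst l) ts0 @ st))"
    unfolding g by simp_all
  have "set ts2 \<subseteq> terms S ar" "snd ` set (?g st) \<subseteq> terms S ar"
    using IH(1) by (simp_all add: image_Un snd_img)
  then have "snd ` set (?g ((l, Node s0 ts0) # st)) \<subseteq> terms S ar"
    unfolding g using wf ts1 ts2 by (auto intro: terms.Node)
  moreover from IH(2) obtain i where "i<length (inner (Suc m) (kids m (fst l) ts0 @ st))"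
       "inner (Suc m) (kids m (fst l) ts0 @ st) ! i = ((y, b), Node s ts)" "key b < key a"
       "map slot (inner (Suc m) (kids m (fst l) ts2 @ ?g st)) =
         (map slot (inner (Suc m) (kids m (fst l) ts0 @ st)))[i := a]"
       "map sym (inner (Suc m) (kids m (fst l) ts2 @ ?g st)) =
         map sym (inner (Suc m) (kids m (fst l) ts0 @ st))"
    by blast
  ultimately show ?case
    unfolding g by (auto intro!: exI[of _ "Suc i"])
qed auto

section \<open>Comparison of two traversals run in parallel\<close>

lemma stack_cases2:
  assumes "map fst st = l # map fst st0"
  obtains st' where "st = (l, Leaf) # st'" "map fst st' = map fst st0"
  | s ts st' where "st = (l, Node s ts) # st'" "map fst st' = map fst st0"
proof -
  obtain t st' where st: "st = (l, t) # st'" "map fst st' = map fst st0"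
    using assms by (auto simp: map_eq_Cons_conv)
  then show ?thesis
    using that by (cases t) auto
qed

lemma fst_kids_cong: "length ts = length ts' \<Longrightarrow> map fst (kids m q ts) = map fst (kids m q ts')"
  by (rule nth_equalityI) (auto simp: nth_kids)

lemma wf_Node:
  assumes "snd ` set ((l, Node s ts) # st) \<subseteq> terms S ar"
  shows "length ts = ar s" "snd ` set (kids m q ts @ st) \<subseteq> terms S ar"
proof -
  have t: "Node s ts \<in> terms S ar"
    using assms by simp
  then show "length ts = ar s"
    by cases auto
  have "snd ` set (kids m q ts) = set ts"
    by (metis list.set_map snd_kids)
  moreover have "set ts \<subseteq> terms S ar"
    using t by cases auto
  ultimately show "snd ` set (kids m q ts @ st) \<subseteq> terms S ar"
    using assms by (auto simp: image_Un)
qed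

text \<open>If only one stack has a leaf on top, the next node of the other takes the top slot,
  whereas its own next node can only take one with smaller key. If both have a node on top, equal
  symbols give equal arities, so the same slots are pushed.\<close>

lemma stack_eqI:
  assumes "valid_stack m st" "map fst st' = map fst st"
    and "snd ` set st \<subseteq> terms S ar" "snd ` set st' \<subseteq> terms S ar"
    and "map slot (inner m st) = map slot (inner m st')" "map sym (inner m st) = map sym (inner m st')"
  shows "st = st'"
  using assms
proof (induction m st arbitrary: st' rule: visit.induct)
  case (2 m l st)
  from 2(3) have "map fst st' = l # map fst st"
    by simp
  then show ?case
  proof (cases rule: stack_cases2)
    case (1 st0)
    then show ?thesis
      using 2(1)[of st0, OF valid_stack_Leaf[OF 2(2)]] 2(4-) by simp
  next
    case (2 s ts st0)
    then obtain e es where e: "inner m st = e # es" "slot e = snd l"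
      using \<open>map slot (inner m ((l, Leaf) # st)) = map slot (inner m st')\<close> by auto
    then show ?thesis
      using inner_hd_less[OF e(1) \<open>valid_stack m ((l, Leaf) # st)\<close>] by simp
  qed
next
  case (3 m l s ts st)
  from 3(3) have "map fst st' = l # map fst st"
    by simp
  then show ?case
  proof (cases rule: stack_cases2)
    case (1 st0)
    then obtain e es where e: "inner m st0 = e # es" "slot e = snd l"
      using 3(6) by (auto simp: map_eq_Cons_conv)
    have "e \<in> set st0"
      using inner_hd[OF e(1)] by blast
    \<comment> \<open>Both stacks carry the same positions and slots, so validity of the first also
      orders the keys of the second.\<close>
    then have "fst e \<in> fst ` set st"
      using 1 by (metis image_eqI list.set_map)
    then have "key (slot e) < key (snd l)"
      using 3(2) by (auto simp: valid_stack_def)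
    then show ?thesis
      using e by simp
  next
    case (2 s' ts' st0)
    then have s: "s' = s"
      using 3(7) by auto
    then have len: "length ts' = length ts"
      using wf_Node(1) 3(4,5) 2 by metis
    have "kids m (fst l) ts @ st = kids m (fst l) ts' @ st0"
    proof (rule 3(1)[OF valid_stack_Node[OF 3(2)]])
      show "map fst (kids m (fst l) ts' @ st0) = map fst (kids m (fst l) ts @ st)"
        using 2 fst_kids_cong[OF len, of m "fst l"] by simp
      show "snd ` set (kids m (fst l) ts @ st) \<subseteq> terms S ar"
        "snd ` set (kids m (fst l) ts' @ st0) \<subseteq> terms S ar"
        using wf_Node(2) 3(4,5) 2 by metis+
    qed (use 3(6,7) 2 s in auto)
    then have "kids m (fst l) ts = kids m (fst l) ts'" "st = st0"
      using len by auto
    then show ?thesis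
      using 2 s snd_kids by metis
  qed
qed auto

text \<open>Up to the first difference both traversals have the same slots on their stacks. There the
  higher term fills a slot that the lower one passes as a leaf, so the last leaf that the lower term
  passes before node \<open>i\<close> is no higher than that slot.\<close>

lemma raise_exists:
  assumes "valid_stack m st" "map fst st' = map fst st"
    and "snd ` set st \<subseteq> terms S ar" "snd ` set st' \<subseteq> terms S ar"
    and "map sym (inner m st) = map sym (inner m st')"
    and "i < length (inner m st)"
    and "\<And>p. p < i \<Longrightarrow> slot (inner m st ! p) = slot (inner m st' ! p)"
    and "key (slot (inner m st ! i)) < key (slot (inner m st' ! i))"
  shows "\<exists>k x. Suc k < length (visit m st) \<and> visit m st ! k = (x, Leaf) \<and>
    visit m st ! Suc k = inner m st ! i \<and> key (snd x) \<le> key (slot (inner m st' ! i))"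
  using assms
proof (induction m st arbitrary: st' i rule: visit.induct)
  case (2 m l st)
  from 2(3) have "map fst st' = l # map fst st"
    by simp
  then show ?case
  proof (cases rule: stack_cases2)
    case (1 st0)
    then obtain k x where "Suc k < length (visit m st)" "visit m st ! k = (x, Leaf)"
      "visit m st ! Suc k = inner m st ! i" "key (snd x) \<le> key (slot (inner m st0 ! i))"
      using 2(1)[OF valid_stack_Leaf[OF 2(2)], of st0 i] 2(3-) by auto
    then show ?thesis
      using 1 by (intro exI[of _ "Suc k"] exI[of _ x]) auto
  next
    case inn: (2 s ts st0)
    obtain e es where e: "inner m st = e # es"
      using 2(7) by (cases "inner m st") auto
    have less: "key (slot e) < key (snd l)"
      using inner_hd_less[OF e 2(2)] by simp
    \<comment> \<open>The next node takes a strictly lower slot here than in the other term, so the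
      first difference is already at index 0.\<close>
    have i: "i = 0"
      using 2(8)[of 0] e less inn by (cases i) auto
    obtain k x where k: "Suc k < length (visit m ((l, Leaf) # st))"
      "visit m ((l, Leaf) # st) ! k = (x, Leaf)" "visit m ((l, Leaf) # st) ! Suc k = e"
      "x \<in> insert l (fst ` set st)"
      using inner_hd[OF e, of l] by blast
    have "key (snd x) \<le> key (snd l)"
      using k(4) 2(2) by (auto simp: valid_stack_def intro: less_imp_le)
    then show ?thesis
      using k e i inn by (intro exI[of _ k] exI[of _ x]) simp
  qed
next
  case (3 m l s ts st)
  from 3(3) have "map fst st' = l # map fst st"
    by simp
  then show ?case
  proof (cases rule: stack_cases2)
    case (1 st0)
    then obtain e es where e: "inner m st0 = e # es"
      using 3(6) by (auto simp: map_eq_Cons_conv)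
    have "e \<in> set st0"
      using inner_hd[OF e] by blast
    then have "fst e \<in> fst ` set st"
      using 1 by (metis image_eqI list.set_map)
    then have "key (slot e) < key (snd l)"
      using 3(2) by (auto simp: valid_stack_def)
    \<comment> \<open>The higher term would have the lower slot at index 0, against the agreement
      before \<open>i\<close> or, if \<open>i = 0\<close>, against the direction of the
      inequality.\<close>
    then show ?thesis
      using e 3(8)[of 0] 3(9) 1 by (cases i) auto
  next
    case (2 s' ts' st0)
    then have s: "s' = s"
      using 3(6) by auto
    then have len: "length ts' = length ts"
      using wf_Node(1) 3(4,5) 2 by metis
    obtain i' where i: "i = Suc i'"
      using 3(9) 2 by (cases i) auto
    have "\<exists>k x. Suc k < length (visit (Suc m) (kids m (fst l) ts @ st)) \<and>
      visit (Suc m) (kids m (fst l) ts @ st) ! k = (x, Leaf) \<and>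
      visit (Suc m) (kids m (fst l) ts @ st) ! Suc k = inner (Suc m) (kids m (fst l) ts @ st) ! i' \<and>
      key (snd x) \<le> key (slot (inner (Suc m) (kids m (fst l) ts' @ st0) ! i'))"
    proof (rule 3(1)[OF valid_stack_Node[OF 3(2)]])
      show "map fst (kids m (fst l) ts' @ st0) = map fst (kids m (fst l) ts @ st)"
        using 2 fst_kids_cong[OF len, of m "fst l"] by simp
      show "slot (inner (Suc m) (kids m (fst l) ts @ st) ! p) =
          slot (inner (Suc m) (kids m (fst l) ts' @ st0) ! p)" if "p < i'" for p
        using 3(8)[of "Suc p"] that i 2 by simp
      show "snd ` set (kids m (fst l) ts @ st) \<subseteq> terms S ar"
        "snd ` set (kids m (fst l) ts' @ st0) \<subseteq> terms S ar"
        using wf_Node(2) 3(4,5) 2 by metis+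
    qed (use 3(6,7,9) 2 s i in auto)
    then obtain k x where "Suc k < length (visit (Suc m) (kids m (fst l) ts @ st))"
      "visit (Suc m) (kids m (fst l) ts @ st) ! k = (x, Leaf)"
      "visit (Suc m) (kids m (fst l) ts @ st) ! Suc k = inner (Suc m) (kids m (fst l) ts @ st) ! i'"
      "key (snd x) \<le> key (slot (inner (Suc m) (kids m (fst l) ts' @ st0) ! i'))"
      by blast
    then show ?thesis
      using 2 i by (intro exI[of _ "Suc k"] exI[of _ x]) auto
  qed
qed auto

subsection \<open>The slots of a term\<close>

lemma visit_terms:
  assumes "snd ` set st \<subseteq> terms S ar"
  shows "snd ` set (visit m st) \<subseteq> terms S ar"
  using assms
proof (induction m st rule: visit.induct)
  case (3 m l s ts st)
  then show ?case
    using wf_Node(2)[OF 3(2)] by simp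
qed auto

definition start :: "'s trm \<Rightarrow> 's entry list" where
  "start t = [(([], 1, 0), t)]"

definition entries :: "'s trm \<Rightarrow> 's entry list" where
  "entries t = inner 1 (start t)"

definition slots :: "'s trm \<Rightarrow> (nat \<times> nat) list" where
  "slots t = map slot (entries t)"

lemma valid_start: "valid_stack 1 (start t)"
  by (simp add: valid_stack_def start_def)

lemma preorder_eq: "preorder t = map pos (visit 1 (start t))"
  by (simp add: pos_visit start_def map_idI)

lemma distinct_preorder: "distinct (preorder t)"
  unfolding preorder_eq by (rule distinct_visit[OF valid_start])

lemma subterm_visit: "e \<in> set (visit 1 (start t)) \<Longrightarrow> subterm t (pos e) = snd e"
  using visit_origin[of e 1 "start t"] by (auto simp: start_def)

lemma nodes_eq: "nodes t = map pos (entries t)"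
  unfolding nodes_def preorder_eq filter_map entries_def inner_def
  by (intro arg_cong[where f = "map _"] filter_cong) (auto simp: subterm_visit)

lemma deg_eq: "deg t = length (entries t)"
  by (simp add: deg_def nodes_eq)

lemma set_entries: "set (entries t) \<subseteq> set (visit 1 (start t))"
  by (auto simp: entries_def inner_def)

lemma dc_eq: "dc t = map sym (entries t)"
  unfolding dc_def nodes_eq map_map
  by (rule map_cong) (use subterm_visit set_entries in fastforce)+

lemma deg_eq_dc: "deg t = length (dc t)"
  by (simp add: deg_eq dc_eq)

lemma node_eq: "i \<in> {1..deg t} \<Longrightarrow> node t i = pos (entries t ! (i - 1))"
  by (auto simp: node_def nodes_eq deg_eq)

lemma distinct_nodes: "distinct (nodes t)"
  unfolding nodes_def using distinct_preorder by (rule distinct_filter)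

lemma entries_0: "entries t \<noteq> [] \<Longrightarrow> entries t ! 0 = (([], 1, 0), t)"
  by (cases t) (auto simp: entries_def start_def)

text \<open>Only the root has the empty position, which excludes the initial slot in
  \<open>inner_parent\<close>. Index \<open>i\<close> is node number \<open>i + 1\<close>, so the
  bound \<open>k \<le> i\<close> says that the parent comes earlier.\<close>

lemma entries_parent:
  assumes "0 < i" "i < length (entries t)" "slot (entries t ! i) = (k, j)"
  shows "1 \<le> k \<and> k \<le> i \<and> 1 \<le> j \<and> j \<le> length (children (snd (entries t ! (k - 1)))) \<and>
    pos (entries t ! i) = pos (entries t ! (k - 1)) @ [j]"
proof -
  have "pos (entries t ! 0) = []"
    using entries_0[of t] assms(2) by (cases "entries t = []") auto
  then have "pos (entries t ! i) \<noteq> []"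
    using distinct_nodes[of t] assms(1,2) unfolding nodes_eq distinct_conv_nth
    by (metis (no_types, lifting) length_map less_trans nth_map order.strict_iff_order)
  then have "(pos (entries t ! i), k, j) \<notin> fst ` set (start t)"
    by (simp add: start_def)
  moreover have "fst (entries t ! i) = (pos (entries t ! i), k, j)"
    using assms(3) by (simp add: prod_eq_iff)
  ultimately show ?thesis
    using inner_parent[of i 1 "start t" "pos (entries t ! i)" k j] assms(2)
    unfolding entries_def by simp
qed

lemma length_slots: "length (slots t) = deg t"
  by (simp add: slots_def deg_eq)

lemma slots_0: "1 \<le> deg t \<Longrightarrow> slots t ! 0 = (1, 0)"
  using entries_0[of t] by (cases "entries t = []") (auto simp: slots_def deg_eq)

text \<open>Node positions are distinct, so the only node whose position is one child number shorter
  is the parent recorded in the slot. The conventional edge comes from the slot of node 1.\<close>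

lemma edges_eq: "edges t = (\<lambda>i. (fst (slots t ! (i - 1)), snd (slots t ! (i - 1)), i)) ` {1..deg t}"
  (is "_ = ?f ` _")
proof (intro equalityI subsetI)
  fix e
  assume "e \<in> edges t"
  then consider i1 j i2 where "e = (i1, j, i2)" "i1 \<in> {1..deg t}" "i2 \<in> {1..deg t}"
      "node t i2 = node t i1 @ [j]" | "deg t \<ge> 1" "e = (1, 0, 1)"
    by (auto simp: edges_def split: if_splits)
  then show "e \<in> ?f ` {1..deg t}"
  proof cases
    case 1
    have pos2: "pos (entries t ! (i2 - 1)) = pos (entries t ! (i1 - 1)) @ [j]"
      using 1 node_eq by metis
    have "i2 - 1 \<noteq> 0"
    proof
      assume "i2 - 1 = 0"
      moreover have "entries t \<noteq> []"
        using 1 by (auto simp: deg_eq)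
      ultimately show False
        using pos2 entries_0[of t] by auto
    qed
    moreover obtain k j' where kj: "slot (entries t ! (i2 - 1)) = (k, j')"
      by fastforce
    ultimately have k: "1 \<le> k" "k \<le> i2 - 1"
      "pos (entries t ! (i2 - 1)) = pos (entries t ! (k - 1)) @ [j']"
      using entries_parent[of "i2 - 1" t k j'] 1 by (auto simp: deg_eq)
    then have "nodes t ! (k - 1) = nodes t ! (i1 - 1)" "j' = j"
      using pos2 1 by (auto simp: nodes_eq deg_eq)
    then have "k - 1 = i1 - 1"
      using k 1 nth_eq_iff_index_eq[OF distinct_nodes, of "k - 1" t "i1 - 1"]
      by (auto simp: nodes_eq deg_eq)
    then have "k = i1"
      using k 1 by auto
    then have "e = ?f i2"
      using 1 kj \<open>j' = j\<close> by (auto simp: slots_def deg_eq)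
    then show ?thesis
      using 1 by blast
  next
    case 2
    then have "e = ?f 1"
      using slots_0[of t] by simp
    then show ?thesis
      using 2 by (intro image_eqI[of _ _ 1]) auto
  qed
next
  fix e
  assume "e \<in> ?f ` {1..deg t}"
  then obtain i where i: "i \<in> {1..deg t}" "e = ?f i"
    by blast
  show "e \<in> edges t"
  proof (cases "i = 1")
    case True
    then have "e = (1, 0, 1)"
      using i slots_0[of t] by auto
    then show ?thesis
      using i by (auto simp: edges_def)
  next
    case False
    obtain k j where kj: "slot (entries t ! (i - 1)) = (k, j)"
      by fastforce
    then have k: "1 \<le> k" "k \<le> i - 1"
      "pos (entries t ! (i - 1)) = pos (entries t ! (k - 1)) @ [j]"
      using entries_parent[of "i - 1" t k j] i False by (auto simp: deg_eq)
    have kd: "k \<in> {1..deg t}"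
      using k i by auto
    then have "node t i = node t k @ [j]"
      using k(3) i node_eq by metis
    moreover have "e = (k, j, i)"
      using i kj by (auto simp: slots_def deg_eq)
    ultimately show ?thesis
      using kd i by (auto simp: edges_def)
  qed
qed

section \<open>Coordinates of a term and the order\<close>

lemma pa_eq:
  assumes "i \<in> {1..deg t}"
  shows "pa t i = fst (slots t ! (i - 1))"
  unfolding pa_def by (rule the_equality) (use assms in \<open>auto simp: edges_eq image_iff\<close>)

lemma lp_eq:
  assumes "i \<in> {1..deg t}"
  shows "lp t i = snd (slots t ! (i - 1))"
  unfolding lp_def by (rule the_equality) (use assms in \<open>auto simp: edges_eq image_iff\<close>)

text \<open>Makes the exponents in \<open>cnc\<close> nonpositive for \<open>cnc_key_le\<close> and
  confines slots to a finite box in \<open>finite_dc_class\<close>.\<close>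

lemma slots_bounds:
  assumes "t \<in> terms S ar" "i \<in> {1..deg t}" "slots t ! (i - 1) = (k, j)"
  shows "k \<in> {1..deg t} \<and> j \<le> ar (dc t ! (k - 1))"
proof (cases "i = 1")
  case True
  then show ?thesis
    using assms slots_0[of t] by auto
next
  case False
  then have k: "1 \<le> k" "k \<le> i - 1" "j \<le> length (children (snd (entries t ! (k - 1))))"
    using entries_parent[of "i - 1" t k j] assms by (auto simp: deg_eq slots_def)
  have lt: "k - 1 < length (entries t)"
    using k assms by (auto simp: deg_eq)
  then have mem: "entries t ! (k - 1) \<in> set (visit 1 (start t))"
    using set_entries nth_mem by blast
  then have "snd (entries t ! (k - 1)) \<in> terms S ar"
    using visit_terms[of "start t" S ar 1] assms(1) by (auto simp: start_def)
  moreover have "snd (entries t ! (k - 1)) \<noteq> Leaf"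
    using nth_mem[OF lt] by (auto simp: entries_def inner_def)
  ultimately have "length (children (snd (entries t ! (k - 1)))) = ar (sym (entries t ! (k - 1)))"
    by cases auto
  then show ?thesis
    using k lt assms by (auto simp: dc_eq deg_eq)
qed

text \<open>Terms with equal decoration words have equal degrees, so the default value never
  distinguishes them.\<close>

definition coord :: "'s trm \<Rightarrow> nat \<Rightarrow> int \<times> int" where
  "coord t i = (if i \<in> {1..deg t} then key (slots t ! (i - 1)) else (0, 0))"

text \<open>The power of two lies in \<open>{0<..1}\<close>, so \<^const>\<open>cnc\<close> compares parents first and then,
  in reverse, child numbers.\<close>

lemma cnc_key_le:
  fixes k j k' j' a a' :: nat
  assumes "j \<le> a" "j' \<le> a'" "k = k' \<Longrightarrow> a = a'"
  shows "real k + 1 - 2 powi (int j - int a) \<le> real k' + 1 - 2 powi (int j' - int a') \<longleftrightarrow>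
    key (k, j) \<le> key (k', j')"
proof -
  have pos: "(0::real) < 2 powi z" for z
    by simp
  have le1: "(2::real) powi z \<le> 1" if "z \<le> 0" for z
    using that power_int_increasing[of z 0 "2::real"] by simp
  consider "k < k'" | "k = k'" | "k' < k"
    by linarith
  then show ?thesis
  proof cases
    case 1
    then have "real k + 1 \<le> real k'"
      by linarith
    then show ?thesis
      using 1 less_imp_le[OF pos[of "int j - int a"]] le1[of "int j' - int a'"] assms(2)
      by (simp add: key_def del: zero_le_power_int zero_less_power_int)
  next
    case 2
    have "(2::real) powi x \<le> 2 powi y \<longleftrightarrow> x \<le> y" for x y
      using power_int_strict_increasing[of y x "2::real"] power_int_increasing[of x y "2::real"]
      by force
    then show ?thesis
      using 2 assms by (auto simp: key_def)
  next
    case 3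
    then have "real k' + 1 \<le> real k"
      by linarith
    then show ?thesis
      using 3 pos[of "int j' - int a'"] le1[of "int j - int a"] assms(1)
      by (simp add: key_def not_le del: zero_less_power_int)
  qed
qed

lemma term_le_iff:
  assumes "t \<in> terms S ar" "u \<in> terms S ar"
  shows "term_le ar t u \<longleftrightarrow> dc t = dc u \<and> coord t \<le> coord u"
proof (cases "dc t = dc u")
  case True
  then have deg: "deg u = deg t"
    by (simp add: deg_eq_dc)
  have "cnc ar t i \<le> cnc ar u i \<longleftrightarrow> coord t i \<le> coord u i" if i: "i \<in> {1..deg t}" for i
  proof -
    obtain k j k' j' where kj: "slots t ! (i - 1) = (k, j)" "slots u ! (i - 1) = (k', j')"
      by fastforce
    have "j \<le> ar (dc t ! (k - 1))" "j' \<le> ar (dc u ! (k' - 1))"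
      using slots_bounds assms i kj deg by metis+
    from cnc_key_le[OF this, of k k'] True i kj deg show ?thesis
      by (simp add: cnc_def pa_eq lp_eq coord_def)
  qed
  moreover have "coord t i = coord u i" if "i \<notin> {1..deg t}" for i
    using that deg unfolding coord_def by (simp only: if_False)
  ultimately show ?thesis
    using True by (auto simp: term_le_def le_fun_def)
qed (auto simp: term_le_def)

lemma key_inject: "key s = key s' \<longleftrightarrow> s = s'"
  by (auto simp: key_def prod_eq_iff)

lemma coord_inject:
  assumes "t \<in> terms S ar" "u \<in> terms S ar" "dc t = dc u" "coord t = coord u"
  shows "t = u"
proof -
  have "slots t = slots u"
  proof (rule nth_equalityI)
    show len: "length (slots t) = length (slots u)"
      using assms(3) by (simp add: length_slots deg_eq_dc)
    fix i
    assume "i < length (slots t)"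
    then show "slots t ! i = slots u ! i"
      using fun_cong[OF assms(4), of "Suc i"] len by (simp add: coord_def length_slots key_inject)
  qed
  then have "start t = start u"
    using assms(1-3) valid_start
    by (intro stack_eqI[of 1 _ _ S ar]) (simp_all add: slots_def entries_def dc_eq, simp_all add: start_def)
  then show ?thesis
    by (simp add: start_def)
qed

text \<open>Within a class the slot list determines the term. It has fixed length, and the sum of
  all arities is a common bound for its child numbers.\<close>

lemma finite_dc_class:
  assumes "t \<in> terms S ar"
  shows "finite {u \<in> terms S ar. dc u = dc t}"
proof -
  let ?B = "{0..deg t} \<times> {0..sum_list (map ar (dc t))}"
  have "inj_on slots {u \<in> terms S ar. dc u = dc t}"
  proof (rule inj_onI)
    fix u v
    assume uv: "u \<in> {u \<in> terms S ar. dc u = dc t}" "v \<in> {u \<in> terms S ar. dc u = dc t}"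
      "slots u = slots v"
    then have "coord u = coord v"
      unfolding coord_def length_slots[symmetric] by (simp only:)
    then show "u = v"
      using uv coord_inject[of u S ar v] by simp
  qed
  moreover have "set (slots u) \<subseteq> ?B \<and> length (slots u) = deg t"
    if u: "u \<in> terms S ar" "dc u = dc t" for u
  proof -
    have deg: "deg u = deg t"
      using u by (simp add: deg_eq_dc)
    have "s \<in> ?B" if "s \<in> set (slots u)" for s
    proof -
      obtain i k j where i: "i < deg u" "slots u ! i = (k, j)" "s = (k, j)"
        using \<open>s \<in> set (slots u)\<close> by (metis in_set_conv_nth length_slots surj_pair)
      have kj: "k \<in> {1..deg u}" "j \<le> ar (dc u ! (k - 1))"
        using slots_bounds[OF u(1), of "Suc i" k j] i by auto
      then have "ar (dc u ! (k - 1)) \<in> set (map ar (dc t))"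
        using u by (auto simp: deg_eq_dc)
      then have "ar (dc u ! (k - 1)) \<le> sum_list (map ar (dc t))"
        by (simp add: member_le_sum_list)
      then show ?thesis
        using kj i deg by auto
    qed
    then show ?thesis
      using deg by (auto simp: length_slots)
  qed
  then have "slots ` {u \<in> terms S ar. dc u = dc t} \<subseteq> {xs. set xs \<subseteq> ?B \<and> length xs = deg t}"
    by blast
  then have "finite (slots ` {u \<in> terms S ar. dc u = dc t})"
    by (rule finite_subset) (simp add: finite_lists_length_eq)
  ultimately show ?thesis
    by (rule finite_imageD[rotated])
qed

section \<open>Moves and their labels in terms of slots\<close>

lemma raise_slots:
  assumes t: "t \<in> terms S ar" and k: "Suc k < length (preorder t)"
    and i: "i \<in> {1..deg t}" and e: "visit 1 (start t) ! k = ((x, a), Leaf)"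
    and y: "preorder t ! Suc k = node t i"
    and t': "t' = replace (replace t (node t i) Leaf) x (subterm t (node t i))"
  shows "t' \<in> terms S ar \<and> dc t' = dc t \<and> slots t' = (slots t)[i - 1 := a] \<and>
    key (slots t ! (i - 1)) < key a"
proof -
  let ?v = "visit 1 (start t)"
  obtain u b where ub: "?v ! Suc k = ((node t i, b), u)"
    using y k unfolding preorder_eq by (metis length_map nth_map prod.collapse)
  have len: "i - 1 < length (entries t)" "Suc k < length ?v"
    using i k by (auto simp: preorder_eq deg_eq)
  then have mem: "((node t i, b), u) \<in> set ?v" "entries t ! (i - 1) \<in> set ?v"
    using ub set_entries by (metis nth_mem subsetD)+
  moreover have "pos (entries t ! (i - 1)) = node t i"
    using node_eq[OF i] by simp
  ultimately have ent: "entries t ! (i - 1) = ((node t i, b), u)"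
    using distinct_preorder[of t] unfolding preorder_eq distinct_map inj_on_def by force
  have "u \<noteq> Leaf"
    using nth_mem[OF len(1), unfolded ent] by (simp add: entries_def inner_def)
  then obtain s ts where u: "u = Node s ts"
    by (cases u) auto
  have sub: "subterm t (node t i) = Node s ts"
    using subterm_visit[OF mem(1)] u by simp
  have st': "map (graft x (Node s ts)) (map (graft (node t i) Leaf) (start t)) = start t'"
    unfolding t' sub by (simp add: start_def graft_def)
  have "snd ` set (start t) \<subseteq> terms S ar"
    using t by (simp add: start_def)
  from visit_raise[OF valid_start _ e ub[unfolded u] this] k
  obtain i' where i': "snd ` set (start t') \<subseteq> terms S ar" "i' < length (entries t)"
    "entries t ! i' = ((node t i, b), Node s ts)" "key b < key a"
    "slots t' = (slots t)[i' := a]" "dc t' = dc t"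
    unfolding st' by (auto simp: preorder_eq slots_def dc_eq entries_def)
  have "i' = i - 1"
  proof -
    have "nodes t ! i' = nodes t ! (i - 1)"
      using i' unfolding node_def[symmetric] by (simp add: nodes_eq)
    moreover have "i' < length (nodes t)" "i - 1 < length (nodes t)"
      using i'(2) len(1) by (simp_all add: nodes_eq)
    ultimately show ?thesis
      using nth_eq_iff_index_eq[OF distinct_nodes] by blast
  qed
  then show ?thesis
    using i' i ent by (auto simp: start_def slots_def deg_eq)
qed

lemma move_raises:
  assumes "t \<in> terms S ar" "move i t t'"
  shows "t' \<in> terms S ar \<and> dc t' = dc t \<and> i \<in> {1..deg t} \<and>
    (\<exists>a. slots t' = (slots t)[i - 1 := a] \<and> key (slots t ! (i - 1)) < key a)"
proof -
  obtain k x where k: "i \<in> {1..deg t}" "Suc k < length (preorder t)" "preorder t ! k = x"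
    "subterm t x = Leaf" "preorder t ! Suc k = node t i"
    "t' = replace (replace t (node t i) Leaf) x (subterm t (node t i))"
    using assms(2) unfolding move_def by blast
  define e where "e = visit 1 (start t) ! k"
  have "pos e = x" "e \<in> set (visit 1 (start t))"
    using k(2,3) by (auto simp: e_def preorder_eq)
  then have "visit 1 (start t) ! k = ((x, slot e), Leaf)"
    using subterm_visit k(4) e_def by (metis prod.collapse)
  from raise_slots[OF assms(1) k(2,1) this k(5,6)] show ?thesis
    using k(1) by blast
qed

lemma move_unique:
  assumes "move i t u" "move i t u'"
  shows "u = u'"
proof -
  obtain k k' where "Suc k < length (preorder t)" "preorder t ! Suc k = node t i"
    "u = replace (replace t (node t i) Leaf) (preorder t ! k) (subterm t (node t i))"
    "Suc k' < length (preorder t)" "preorder t ! Suc k' = node t i"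
    "u' = replace (replace t (node t i) Leaf) (preorder t ! k') (subterm t (node t i))"
    using assms unfolding move_def by blast
  moreover from this have "Suc k = Suc k'"
    using distinct_preorder nth_eq_iff_index_eq by metis
  ultimately show ?thesis
    by simp
qed

lemma move_coord:
  assumes "t \<in> terms S ar" "move i t t'"
  shows "\<exists>v>coord t i. coord t' = (coord t)(i := v)"
proof -
  obtain a where a: "dc t' = dc t" "i \<in> {1..deg t}" "slots t' = (slots t)[i - 1 := a]"
    "key (slots t ! (i - 1)) < key a"
    using move_raises[OF assms] by blast
  have deg: "deg t' = deg t"
    using a(1) by (simp add: deg_eq_dc)
  have "coord t' = (coord t)(i := key a)"
    using a deg by (auto simp: coord_def fun_eq_iff nth_list_update length_slots)
  then show ?thesis
    using a by (intro exI[of _ "key a"]) (simp add: coord_def)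
qed

text \<open>\<open>raise_exists\<close> finds a leaf just before node \<open>i\<close> whose slot is
  no higher than that of \<open>i\<close> in \<open>u\<close>; node \<open>i\<close> is moved onto
  it. Coordinate \<open>i\<close> belongs to list index \<open>i - 1\<close>.\<close>

lemma move_exists:
  assumes "t \<in> terms S ar" "u \<in> terms S ar" "term_le ar t u" "coord t i < coord u i"
    and "\<And>m. m < i \<Longrightarrow> coord t m = coord u m"
  shows "\<exists>t'. move i t t' \<and> coord t' i \<le> coord u i"
proof -
  have dc: "dc t = dc u" and deg: "deg u = deg t"
    using assms(3) by (auto simp: term_le_def deg_eq_dc)
  \<comment> \<open>Outside the numbering both coordinates are the default, which the strict
    inequality excludes.\<close>
  have i: "i \<in> {1..deg t}"
    using assms(4) deg by (auto simp: coord_def split: if_splits)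
  have "\<exists>k x. Suc k < length (visit 1 (start t)) \<and> visit 1 (start t) ! k = (x, Leaf) \<and>
    visit 1 (start t) ! Suc k = inner 1 (start t) ! (i - 1) \<and>
    key (snd x) \<le> key (slot (inner 1 (start u) ! (i - 1)))"
  proof (rule raise_exists[OF valid_start])
    show "i - 1 < length (inner 1 (start t))"
      using i by (auto simp: deg_eq entries_def)
    show "key (slot (inner 1 (start t) ! (i - 1))) < key (slot (inner 1 (start u) ! (i - 1)))"
      using assms(4) i deg by (auto simp: coord_def slots_def deg_eq entries_def)
    show "slot (inner 1 (start t) ! p) = slot (inner 1 (start u) ! p)" if "p < i - 1" for p
      using assms(5)[of "Suc p"] that i deg
      by (auto simp: coord_def slots_def deg_eq entries_def key_inject)
    show "map sym (inner 1 (start t)) = map sym (inner 1 (start u))"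
      using dc by (simp add: dc_eq entries_def)
  qed (use assms in \<open>auto simp: start_def\<close>)
  then obtain k x a where k: "Suc k < length (visit 1 (start t))"
    "visit 1 (start t) ! k = ((x, a), Leaf)" "visit 1 (start t) ! Suc k = entries t ! (i - 1)"
    "key a \<le> key (slot (entries u ! (i - 1)))"
    by (auto simp: entries_def)
  let ?t' = "replace (replace t (node t i) Leaf) x (subterm t (node t i))"
  have k': "Suc k < length (preorder t)" "preorder t ! k = x" "preorder t ! Suc k = node t i"
    using k node_eq[OF i] by (simp_all add: preorder_eq)
  have "((x, a), Leaf) \<in> set (visit 1 (start t))"
    using k by (metis Suc_lessD nth_mem)
  then have "subterm t x = Leaf"
    using subterm_visit by fastforce
  then have "move i t ?t'"
    unfolding move_def using k' i by blast
  moreover have "dc ?t' = dc t" "slots ?t' = (slots t)[i - 1 := a]"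
    using raise_slots[OF assms(1) k'(1) i k(2) k'(3) refl] by auto
  then have "coord ?t' i \<le> coord u i"
    using i k(4) deg length_slots[of t] length_slots[of u]
    by (auto simp: coord_def deg_eq_dc slots_def)
  ultimately show ?thesis
    by blast
qed

text \<open>There is one edge per node by \<open>edges_eq\<close>, and only the slot of node
  \<open>i\<close> changes, so exactly one edge disappears.\<close>

lemma edge_label_move:
  assumes "t \<in> terms S ar" "move i t t'"
  shows "edge_label t t' = (int i, coord t i)"
proof -
  obtain a where a: "dc t' = dc t" "i \<in> {1..deg t}" "slots t' = (slots t)[i - 1 := a]"
    "key (slots t ! (i - 1)) < key a"
    using move_raises[OF assms] by blast
  have deg: "deg t' = deg t"
    using a(1) by (simp add: deg_eq_dc)
  let ?s = "slots t ! (i - 1)"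
  have ne: "a \<noteq> ?s"
    using a(4) by auto
  have "slots t' ! (m - 1) = (if m = i then a else slots t ! (m - 1))" if "m \<in> {1..deg t}" for m
    using that a by (auto simp: nth_list_update length_slots)
  then have "edges t - edges t' = {(fst ?s, snd ?s, i)}"
    using a(2) ne unfolding edges_eq deg
    by (auto simp: image_iff prod_eq_iff split: if_splits)
  moreover have "step t t'"
    using assms(2) a(2) by (auto simp: step_def)
  ultimately show ?thesis
    unfolding edge_label_def by (auto simp: coord_def key_def a(2)[simplified])
qed

section \<open>The poset of terms as a raising system\<close>

interpretation moves: raising_system "terms S ar" "term_le ar" dc coord move edge_label
  for S :: "'s set" and ar :: "'s \<Rightarrow> nat"
proof (unfold_locales, goal_cases)
  case 1
  then show ?case
    by (rule term_le_iff)
next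
  case 2
  then show ?case
    by (rule coord_inject)
next
  case 3
  then show ?case
    by (rule finite_dc_class)
next
  case 6
  then show ?case
    by (rule move_coord)
next
  case 7
  then show ?case
    by (blast intro: move_unique)
next
  case 8
  then show ?case
    by (rule move_exists)
qed (simp_all add: move_raises edge_label_move)

theorem theorem3p1p5:
  fixes S :: "'s set" and ar :: "'s \<Rightarrow> nat"
  shows "EL_labeling (terms S ar) (term_le ar) edge_label \<and>
    (\<forall>t1\<in>terms S ar. \<forall>t2\<in>terms S ar. term_le ar t1 t2 \<longrightarrow>
       (\<exists>\<^sub>\<le>\<^sub>1c. saturated_chain (terms S ar) (term_le ar) t1 t2 c \<and>
          label_weakly_decreasing edge_label c))"
  using moves.EL moves.weakly_decreasing_unique unfolding Uniq_def by blast

end
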